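(* Let $K\ge1$ and, for $i=1,\dots,K$, let $\delta_i\in\mathbb{R}$, $\alpha_i>0$, $\beta_i\in\mathbb{R}$. Then the Gaussian mixture $$f(x)=\sum_{i=1}^K\delta_i\,\phi(\alpha_ix+\beta_i),\qquad x\in\mathbb{R},$$ has at most finitely many sign-changing zeros, and there is a bounded interval containing all of them. Hence the same holds for every function of the form $$w(x)=\sum_{i=1}^K\mu_i\,\Phi(\alpha_ix+\beta_i),\qquad x\in\mathbb{R},$$ with $\mu_i\in\mathbb{R}$ (whose derivative is $Dw(x)=\sum_{i=1}^K\mu_i\alpha_i\phi(\alpha_ix+\beta_i)$): $w$ has at most finitely many sign-changing zeros and there is a bounded interval containing all of them.
   Context: $\phi(x)=\frac1{\sqrt{2\pi}}e^{-x^2/2}$ is the standard Gaussian density and $\Phi(x)=\int_{-\infty}^x\phi(y)\,dy$ is the standard Gaussian cumulative distribution function. A sign-changing zero of a function $g:\mathbb{R}\to\mathbb{R}$ is a point $x_0$ with $g(x_0)=0$ for which there is $\epsilon>0$ such that $g(y)\,g(z)<0$ for all $y,z\in(x_0-\epsilon,x_0+\epsilon)$ with $y<x_0<z$. *)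

theory Defs
  imports "HOL-Probability.Probability"
begin

text \<open>The standard Gaussian density is the library's \<^term>\<open>std_normal_density\<close>.\<close>

definition std_normal_cdf :: "real \<Rightarrow> real" where
  "std_normal_cdf x = (LBINT y:{..x}. std_normal_density y)"

definition sign_changing_zero :: "(real \<Rightarrow> real) \<Rightarrow> real \<Rightarrow> bool" where
  "sign_changing_zero g x0 \<longleftrightarrow>
     g x0 = 0 \<and>
     (\<exists>\<epsilon>>0. \<forall>y\<in>{x0 - \<epsilon><..<x0 + \<epsilon>}. \<forall>z\<in>{x0 - \<epsilon><..<x0 + \<epsilon>}.
        y < x0 \<and> x0 < z \<longrightarrow> g y * g z < 0)"

definition gauss_density_mixture ::
  "nat \<Rightarrow> (nat \<Rightarrow> real) \<Rightarrow> (nat \<Rightarrow> real) \<Rightarrow> (nat \<Rightarrow> real) \<Rightarrow> real \<Rightarrow> real" where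
  "gauss_density_mixture K \<delta> \<alpha> \<beta> x = (\<Sum>i=1..K. \<delta> i * std_normal_density (\<alpha> i * x + \<beta> i))"

definition gauss_cdf_mixture ::
  "nat \<Rightarrow> (nat \<Rightarrow> real) \<Rightarrow> (nat \<Rightarrow> real) \<Rightarrow> (nat \<Rightarrow> real) \<Rightarrow> real \<Rightarrow> real" where
  "gauss_cdf_mixture K \<mu> \<alpha> \<beta> x = (\<Sum>i=1..K. \<mu> i * std_normal_cdf (\<alpha> i * x + \<beta> i))"

end

theory Submission
  imports Defs
begin

text \<open>
  Gaussian mixtures belong to the class of exponential polynomials, the finite sums of terms
  \<open>P(x) exp(q(x))\<close> with polynomials \<open>P\<close> and \<open>q\<close>. Each such sum vanishes identically or has
  finitely many zeros: dividing by one exponential turns its term into a polynomial, which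
  repeated differentiation removes without increasing the number of the other terms, and by Rolle's
  theorem a function has finitely many zeros or is constant when its derivative has finitely many
  zeros or vanishes identically. The same step passes from \<open>Dw\<close> to \<open>w\<close>.
\<close>

definition zero_or_finite_zeros :: "(real \<Rightarrow> real) \<Rightarrow> bool" where
  "zero_or_finite_zeros f \<longleftrightarrow> (\<forall>x. f x = 0) \<or> finite {x. f x = 0}"

text \<open>By Rolle's theorem a zero of \<open>f'\<close> lies strictly between any two zeros of
  \<open>f\<close>. Sending a zero of \<open>f\<close> to the set of zeros of \<open>f'\<close> on
  its right is therefore injective, with values in a finite power set.\<close>

lemma finite_zeros_of_finite_zeros_deriv:
  fixes f f' :: "real \<Rightarrow> real"
  assumes deriv: "\<And>x. (f has_real_derivative f' x) (at x)"
    and fin: "finite {x. f' x = 0}"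
  shows "finite {x. f x = 0}"
proof (rule inj_on_finite)
  define below where "below z = {x. f' x = 0 \<and> x < z}" for z
  have separated: "below y \<noteq> below z" if zeros: "f y = 0" "f z = 0" and "y < z" for y z
  proof -
    have "\<exists>c. y < c \<and> c < z \<and> f z - f y = (z - y) * f' c"
      using MVT2[of y z f f'] deriv \<open>y < z\<close> by blast
    then obtain c where "y < c" "c < z" "f' c = 0"
      using zeros \<open>y < z\<close> by auto
    then have "c \<in> below z" "c \<notin> below y"
      by (auto simp: below_def)
    then show ?thesis by blast
  qed
  show "inj_on below {x. f x = 0}"
    unfolding inj_on_def using separated by (metis (mono_tags) linorder_neqE mem_Collect_eq)
  show "below ` {x. f x = 0} \<subseteq> Pow {x. f' x = 0}"
    by (auto simp: below_def)
  show "finite (Pow {x. f' x = 0})"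
    using fin by simp
qed

lemma zero_or_finite_zeros_of_deriv:
  fixes f f' :: "real \<Rightarrow> real"
  assumes deriv: "\<And>x. (f has_real_derivative f' x) (at x)"
    and "zero_or_finite_zeros f'"
  shows "zero_or_finite_zeros f"
proof (cases "\<forall>x. f' x = 0")
  case True
  then have "f x = f 0" for x
    using DERIV_isconst_all[of f x 0] deriv by metis
  then have "(\<forall>x. f x = 0) \<or> {x. f x = 0} = {}"
    by (metis (mono_tags, lifting) empty_Collect_eq)
  then show ?thesis
    by (auto simp: zero_or_finite_zeros_def)
next
  case False
  then show ?thesis
    using finite_zeros_of_finite_zeros_deriv[OF deriv] assms(2)
    by (auto simp: zero_or_finite_zeros_def)
qed

text \<open>The polynomial \<open>p\<close> is kept apart from the exponential terms because it is
  the part that differentiation lowers in degree. The outer induction is on the number of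
  exponentials, with \<open>q\<close> arbitrary since dividing by an exponential shifts all
  exponents.\<close>

lemma zero_or_finite_zeros_exp_poly:
  fixes p :: "real poly" and P q :: "'i \<Rightarrow> real poly"
  assumes "finite I"
  shows "zero_or_finite_zeros (\<lambda>x. poly p x + (\<Sum>i\<in>I. poly (P i) x * exp (poly (q i) x)))"
  using assms
proof (induction I arbitrary: p P q rule: finite_induct)
  case empty
  then show ?case
    using poly_roots_finite[of p] by (cases "p = 0") (auto simp: zero_or_finite_zeros_def)
next
  case (insert j I)
  \<comment> \<open>An inner induction on a bound \<open>n\<close> for the degree of
    \<open>p\<close>, with \<open>q\<close> fixed. The disjunct \<open>p = 0\<close> makes the bound
    0 mean exactly that \<open>p\<close> has been removed.\<close>
  have "zero_or_finite_zeros (\<lambda>x. poly p x + (\<Sum>i\<in>insert j I. poly (P i) x * exp (poly (q i) x)))"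
    if "p = 0 \<or> degree p < n" for n p P
    using that
  proof (induction n arbitrary: p P)
    case 0
    \<comment> \<open>With \<open>p = 0\<close>, factoring out the nowhere vanishing exponential of
      \<open>q j\<close> leaves \<open>P j\<close> as the new polynomial part and one exponential
      fewer, so the outer hypothesis applies.\<close>
    have factor: "poly p x + (\<Sum>i\<in>insert j I. poly (P i) x * exp (poly (q i) x)) =
      exp (poly (q j) x) *
        (poly (P j) x + (\<Sum>i\<in>I. poly (P i) x * exp (poly (q i - q j) x)))" for x
      using 0 insert.hyps by (simp add: sum_distrib_left exp_diff algebra_simps)
    show ?case
      using insert.IH[of "P j" P "\<lambda>i. q i - q j"]
      unfolding zero_or_finite_zeros_def factor by simp
  next
    case (Suc n)
    \<comment> \<open>By the product rule, differentiation changes the coefficients of the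
      exponentials but not their exponents.\<close>
    define P' where "P' i = pderiv (P i) + P i * pderiv (q i)" for i
    have smaller: "pderiv p = 0 \<or> degree (pderiv p) < n"
      using Suc.prems by (cases "degree p") (auto simp: degree_pderiv pderiv_eq_0_iff)
    have "((\<lambda>x. poly p x + (\<Sum>i\<in>insert j I. poly (P i) x * exp (poly (q i) x)))
        has_real_derivative
        (poly (pderiv p) x + (\<Sum>i\<in>insert j I. poly (P' i) x * exp (poly (q i) x)))) (at x)" for x
      unfolding P'_def
      by (intro derivative_eq_intros DERIV_sum poly_DERIV refl)
        (auto intro!: sum.cong simp: algebra_simps)
    then show ?case
      by (rule zero_or_finite_zeros_of_deriv) (rule Suc.IH[OF smaller])
  qed
  from this[of p "Suc (degree p)" P] show ?case by simp
qed

lemma zero_or_finite_zeros_gauss_density_sum: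
  fixes \<delta> \<alpha> \<beta> :: "'i \<Rightarrow> real"
  assumes "finite I"
  shows "zero_or_finite_zeros (\<lambda>x. \<Sum>i\<in>I. \<delta> i * std_normal_density (\<alpha> i * x + \<beta> i))"
proof -
  have "\<delta> i * std_normal_density (\<alpha> i * x + \<beta> i) =
      poly [:\<delta> i / sqrt (2 * pi):] x * exp (poly (smult (- 1 / 2) ([:\<beta> i, \<alpha> i:] ^ 2)) x)" for i x
    by (simp add: std_normal_density_def algebra_simps)
  then show ?thesis
    using zero_or_finite_zeros_exp_poly[OF assms, of 0 "\<lambda>i. [:\<delta> i / sqrt (2 * pi):]"
        "\<lambda>i. smult (- 1 / 2) ([:\<beta> i, \<alpha> i:] ^ 2)"]
    by (simp only: poly_0 add_0_left)
qed

text \<open>Cutting the half-line at \<open>x - 1\<close> leaves a constant plus an integral over a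
  compact interval, to which the fundamental theorem of calculus applies; \<open>x\<close> is
  interior to \<open>{x - 1..x + 1}\<close>, so the derivative is two-sided.\<close>

lemma std_normal_cdf_has_real_derivative:
  "(std_normal_cdf has_real_derivative std_normal_density x) (at x)"
proof -
  have integrable: "set_integrable lborel A std_normal_density" if "A \<in> sets lborel" for A
    using integrable_mult_indicator[OF that integrable_normal_density[of 1 0]]
    by (simp add: set_integrable_def)
  have continuous: "continuous_on A std_normal_density" for A
    unfolding std_normal_density_def by (intro continuous_intros) auto
  have split: "std_normal_cdf y = std_normal_cdf (x - 1) + integral {x - 1..y} std_normal_density"
    if "x - 1 \<le> y" for y
  proof -
    have "{..y} = {..x - 1} \<union> {x - 1<..y}" and "{..x - 1} \<inter> {x - 1<..y} = {}"
      using that by auto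
    then have "std_normal_cdf y =
        std_normal_cdf (x - 1) + (LBINT t:{x - 1<..y}. std_normal_density t)"
      unfolding std_normal_cdf_def
      by (simp only:) (intro set_integral_Un integrable; simp)
    \<comment> \<open>The two intervals differ by the null set \<open>{x - 1}\<close>.\<close>
    also have "(LBINT t:{x - 1<..y}. std_normal_density t) =
        (LBINT t:{x - 1..y}. std_normal_density t)"
      using that by (intro set_integral_cong_set)
        (auto simp: set_borel_measurable_def intro!: AE_I[where N="{x - 1}"])
    also have "\<dots> = integral {x - 1..y} std_normal_density"
      by (intro set_borel_integral_eq_integral integrable) simp
    finally show ?thesis .
  qed
  have "((\<lambda>y. integral {x - 1..y} std_normal_density) has_real_derivative std_normal_density x)
      (at x within {x - 1..x + 1})"
    by (intro integral_has_real_derivative continuous) auto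
  then have "((\<lambda>y. integral {x - 1..y} std_normal_density) has_real_derivative
      std_normal_density x) (at x)"
    by (simp add: at_within_Icc_at)
  then have "((\<lambda>y. std_normal_cdf (x - 1) + integral {x - 1..y} std_normal_density)
      has_real_derivative std_normal_density x) (at x)"
    by (auto intro!: derivative_eq_intros)
  then show ?thesis
    \<comment> \<open>The identity \<open>split\<close> is known only for y \<ge> x - 1, which
      covers an open neighbourhood of \<open>x\<close>.\<close>
    by (rule has_field_derivative_transform_within_open[where S = "{x - 1<..}"])
      (auto intro: split[symmetric])
qed

lemma finite_sign_changing_zeros:
  assumes "zero_or_finite_zeros f"
  shows "finite {x. sign_changing_zero f x}"
proof (cases "\<forall>x. f x = 0")
  case True
  \<comment> \<open>The zero function has infinitely many zeros, but none with a sign change: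
    products of its values are never negative.\<close>
  have "\<not> sign_changing_zero f x" for x
  proof
    assume "sign_changing_zero f x"
    then obtain \<epsilon> where "\<epsilon> > 0"
      and "\<forall>y\<in>{x - \<epsilon><..<x + \<epsilon>}. \<forall>z\<in>{x - \<epsilon><..<x + \<epsilon>}. y < x \<and> x < z \<longrightarrow> f y * f z < 0"
      by (auto simp: sign_changing_zero_def)
    then have "f (x - \<epsilon> / 2) * f (x + \<epsilon> / 2) < 0"
      by simp
    then show False
      using True by simp
  qed
  then show ?thesis by simp
next
  case False
  then have "finite {x. f x = 0}"
    using assms by (auto simp: zero_or_finite_zeros_def)
  then show ?thesis
    by (rule rev_finite_subset) (auto simp: sign_changing_zero_def)
qed

lemma finite_subset_Icc:
  fixes S :: "real set"
  assumes "finite S"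
  shows "\<exists>a b. S \<subseteq> {a..b}"
  using bounded_subset_cbox_symmetric[OF finite_imp_bounded[OF assms]] by (metis cbox_interval)

theorem lemma22:
  fixes K :: nat and \<alpha> \<beta> :: "nat \<Rightarrow> real"
  assumes "K \<ge> 1"
    and "\<And>i. i \<in> {1..K} \<Longrightarrow> \<alpha> i > 0"
  shows
    "(\<forall>\<delta> :: nat \<Rightarrow> real.
        finite {x. sign_changing_zero (gauss_density_mixture K \<delta> \<alpha> \<beta>) x} \<and>
        (\<exists>a b :: real. {x. sign_changing_zero (gauss_density_mixture K \<delta> \<alpha> \<beta>) x} \<subseteq> {a..b})) \<and>
     (\<forall>\<mu> :: nat \<Rightarrow> real.
        (\<forall>x. (gauss_cdf_mixture K \<mu> \<alpha> \<beta> has_real_derivative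
               (\<Sum>i=1..K. \<mu> i * \<alpha> i * std_normal_density (\<alpha> i * x + \<beta> i))) (at x)) \<and>
        finite {x. sign_changing_zero (gauss_cdf_mixture K \<mu> \<alpha> \<beta>) x} \<and>
        (\<exists>a b :: real. {x. sign_changing_zero (gauss_cdf_mixture K \<mu> \<alpha> \<beta>) x} \<subseteq> {a..b}))"
proof (intro conjI allI)
  fix \<delta> :: "nat \<Rightarrow> real"
  have "zero_or_finite_zeros (gauss_density_mixture K \<delta> \<alpha> \<beta>)"
    using zero_or_finite_zeros_gauss_density_sum[of "{1..K}" \<delta> \<alpha> \<beta>]
    by (simp add: gauss_density_mixture_def[abs_def])
  then show fin: "finite {x. sign_changing_zero (gauss_density_mixture K \<delta> \<alpha> \<beta>) x}"
    by (rule finite_sign_changing_zeros)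
  show "\<exists>a b. {x. sign_changing_zero (gauss_density_mixture K \<delta> \<alpha> \<beta>) x} \<subseteq> {a..b}"
    by (rule finite_subset_Icc[OF fin])
next
  fix \<mu> :: "nat \<Rightarrow> real"
  show deriv: "(gauss_cdf_mixture K \<mu> \<alpha> \<beta> has_real_derivative
      (\<Sum>i=1..K. \<mu> i * \<alpha> i * std_normal_density (\<alpha> i * x + \<beta> i))) (at x)" for x
    unfolding gauss_cdf_mixture_def[abs_def]
    by (intro DERIV_sum)
      (auto intro!: derivative_eq_intros DERIV_chain2[OF std_normal_cdf_has_real_derivative])
  \<comment> \<open>The derivative is itself a Gaussian density sum, with coefficients \<mu> i *
    \<alpha> i.\<close>
  have "zero_or_finite_zeros (gauss_cdf_mixture K \<mu> \<alpha> \<beta>)"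
    using deriv by (rule zero_or_finite_zeros_of_deriv)
      (rule zero_or_finite_zeros_gauss_density_sum, simp)
  then show fin: "finite {x. sign_changing_zero (gauss_cdf_mixture K \<mu> \<alpha> \<beta>) x}"
    by (rule finite_sign_changing_zeros)
  show "\<exists>a b. {x. sign_changing_zero (gauss_cdf_mixture K \<mu> \<alpha> \<beta>) x} \<subseteq> {a..b}"
    by (rule finite_subset_Icc[OF fin])
qed

end
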